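(* Let $G$ be a Cayley graph of a finite group $\Gamma$ that is nilpotent of class $\le n$, and let $r\ge 2^{n+1}$. If $G$ has an $r$-local cutvertex, then $G$ is a cycle of length greater than $r$ and $\Gamma$ is cyclic.
   Context: A generating set $S$ does not contain the neutral element $\mathbb{I}$ and is closed under inverses; the Cayley graph $\mathrm{Cay}(\Gamma,S)$ is the simple graph on $\Gamma$ with edges $\{g,gs\}$, $g\in\Gamma$, $s\in S$. $a\equiv b$ means $a=b$ or $a=b^{-1}$. Iterated commutators: $[g,h]_1:=gh^{-1}g^{-1}h$, $[g,h]_n$ the reduced form of $g[g,h]_{n-1}^{-1}g^{-1}[g,h]_{n-1}$; $\Gamma$ is nilpotent of class $\le n$ if $[g,h]_n=\mathbb{I}$ for all $g\not\equiv h$ in $\Gamma$. The ball $B_r(v)$ around a vertex $v$ is the subgraph consisting of all vertices and edges on closed walks of length at most $r$ through $v$; $v$ is an $r$-local cutvertex if $B_r(v)-v$ is disconnected. *)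

theory Defs
  imports "HOL-Algebra.Elementary_Groups"
begin

text \<open>iter_comm G k g h is the iterated commutator [g,h]_k. We set [g,h]_0 = h,
  so that [g,h]_1 = g h^-1 g^-1 h and [g,h]_(k+1) = g [g,h]_k^-1 g^-1 [g,h]_k.\<close>
fun iter_comm :: "('a, 'b) monoid_scheme \<Rightarrow> nat \<Rightarrow> 'a \<Rightarrow> 'a \<Rightarrow> 'a" where
  "iter_comm G 0 g h = h"
| "iter_comm G (Suc k) g h =
     g \<otimes>\<^bsub>G\<^esub> inv\<^bsub>G\<^esub> (iter_comm G k g h) \<otimes>\<^bsub>G\<^esub> inv\<^bsub>G\<^esub> g \<otimes>\<^bsub>G\<^esub> iter_comm G k g h"

definition equiv_inv :: "('a, 'b) monoid_scheme \<Rightarrow> 'a \<Rightarrow> 'a \<Rightarrow> bool" where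
  "equiv_inv G a b \<longleftrightarrow> a = b \<or> a = inv\<^bsub>G\<^esub> b"

definition nilpotent_class_le :: "('a, 'b) monoid_scheme \<Rightarrow> nat \<Rightarrow> bool" where
  "nilpotent_class_le G n \<longleftrightarrow>
     (\<forall>g\<in>carrier G. \<forall>h\<in>carrier G. \<not> equiv_inv G g h \<longrightarrow> iter_comm G n g h = \<one>\<^bsub>G\<^esub>)"

definition generating_set :: "('a, 'b) monoid_scheme \<Rightarrow> 'a set \<Rightarrow> bool" where
  "generating_set G S \<longleftrightarrow> S \<subseteq> carrier G \<and> \<one>\<^bsub>G\<^esub> \<notin> S
     \<and> (\<forall>s\<in>S. inv\<^bsub>G\<^esub> s \<in> S) \<and> generate G S = carrier G"

definition cayley_adj :: "('a, 'b) monoid_scheme \<Rightarrow> 'a set \<Rightarrow> 'a \<Rightarrow> 'a \<Rightarrow> bool" where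
  "cayley_adj G S x y \<longleftrightarrow> x \<in> carrier G \<and> y \<in> carrier G \<and>
     ((\<exists>s\<in>S. y = x \<otimes>\<^bsub>G\<^esub> s) \<or> (\<exists>s\<in>S. x = y \<otimes>\<^bsub>G\<^esub> s))"

definition walk :: "'a set \<Rightarrow> ('a \<Rightarrow> 'a \<Rightarrow> bool) \<Rightarrow> 'a list \<Rightarrow> bool" where
  "walk V E xs \<longleftrightarrow> xs \<noteq> [] \<and> set xs \<subseteq> V \<and>
     (\<forall>i. Suc i < length xs \<longrightarrow> E (xs ! i) (xs ! Suc i))"

text \<open>A closed walk of length at most r through v (length = number of edges).\<close>
definition closed_walk_through :: "'a set \<Rightarrow> ('a \<Rightarrow> 'a \<Rightarrow> bool) \<Rightarrow> nat \<Rightarrow> 'a \<Rightarrow> 'a list \<Rightarrow> bool" where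
  "closed_walk_through V E r v xs \<longleftrightarrow> walk V E xs \<and> hd xs = last xs
     \<and> length xs \<le> Suc r \<and> v \<in> set xs"

definition ball_verts :: "'a set \<Rightarrow> ('a \<Rightarrow> 'a \<Rightarrow> bool) \<Rightarrow> nat \<Rightarrow> 'a \<Rightarrow> 'a set" where
  "ball_verts V E r v = {x. \<exists>xs. closed_walk_through V E r v xs \<and> x \<in> set xs}"

definition ball_edge :: "'a set \<Rightarrow> ('a \<Rightarrow> 'a \<Rightarrow> bool) \<Rightarrow> nat \<Rightarrow> 'a \<Rightarrow> 'a \<Rightarrow> 'a \<Rightarrow> bool" where
  "ball_edge V E r v x y \<longleftrightarrow> (\<exists>xs. closed_walk_through V E r v xs \<and>
     (\<exists>i. Suc i < length xs \<and>
        ((xs ! i = x \<and> xs ! Suc i = y) \<or> (xs ! i = y \<and> xs ! Suc i = x))))"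

definition local_cutvertex :: "'a set \<Rightarrow> ('a \<Rightarrow> 'a \<Rightarrow> bool) \<Rightarrow> nat \<Rightarrow> 'a \<Rightarrow> bool" where
  "local_cutvertex V E r v \<longleftrightarrow> v \<in> V \<and>
     (\<exists>a b. a \<in> ball_verts V E r v - {v} \<and> b \<in> ball_verts V E r v - {v} \<and>
        \<not> (\<lambda>x y. ball_edge V E r v x y \<and> x \<noteq> v \<and> y \<noteq> v)\<^sup>*\<^sup>* a b)"

definition is_cycle_graph :: "'a set \<Rightarrow> ('a \<Rightarrow> 'a \<Rightarrow> bool) \<Rightarrow> nat \<Rightarrow> bool" where
  "is_cycle_graph V E m \<longleftrightarrow> m \<ge> 3 \<and> (\<exists>f. bij_betw f {..<m} V \<and>
     (\<forall>x y. E x y \<longleftrightarrow> (\<exists>i<m. (x = f i \<and> y = f (Suc i mod m)) \<or> (y = f i \<and> x = f (Suc i mod m)))))"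

end

theory Submission
  imports Defs "HOL-Algebra.Multiplicative_Group" "HOL-Library.Sublist"
begin

text \<open>Call two generators \<open>s\<close>, \<open>t\<close> linked if \<open>v s\<close> and \<open>v t\<close> lie in the same component of the
  punctured ball around \<open>v\<close>. A word that represents \<open>\<one>\<close>, while none of its proper nonempty subwords
  does, traces a cycle. If its length is at most \<open>r\<close>, rotating it so that any given corner is at \<open>v\<close>
  shows that \<open>inv x\<close> and \<open>y\<close> are linked for cyclically consecutive letters \<open>x\<close>, \<open>y\<close>. The reduced
  word of \<open>[g,h]\<^sub>n\<close> has length \<open>2 ^ (n + 1)\<close>, its letters alternate between \<open>g\<close> and \<open>h\<close>, and among
  any four consecutive signs two neighbouring ones agree. This is enough for the cycle inside that
  word to link \<open>g\<close>, \<open>h\<close> and their inverses. Hence a local cutvertex leaves only \<open>S = {s, inv s}\<close>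
  with \<open>s\<close> and \<open>inv s\<close> not linked, which forces the order of \<open>s\<close> to exceed \<open>r\<close>.\<close>

section \<open>Contiguous sublists\<close>

lemma successively_iff_sublist: "successively P w \<longleftrightarrow> (\<forall>x y. sublist [x, y] w \<longrightarrow> P x y)"
proof (induction P w rule: successively.induct)
  case (3 P x y w)
  then show ?case by (auto simp: sublist_Cons_right)
qed (auto simp: sublist_Cons_right)

lemma successively_sublist: "successively P w \<Longrightarrow> sublist u w \<Longrightarrow> successively P u"
  by (auto simp: sublist_def successively_append_iff)

lemma successively_imp_rtranclp_hd_last:
  "successively R w \<Longrightarrow> w \<noteq> [] \<Longrightarrow> R\<^sup>*\<^sup>* (hd w) (last w)"
proof (induction R w rule: successively.induct)
  case (3 R x y w)
  then show ?case by (auto intro: converse_rtranclp_into_rtranclp)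
qed auto

definition alternation_le :: "nat \<Rightarrow> 'a list \<Rightarrow> bool" where
  "alternation_le k w \<longleftrightarrow> (\<forall>u. sublist u w \<longrightarrow> distinct_adj u \<longrightarrow> length u \<le> k)"

lemma alternation_le_if_short: "length w \<le> k \<Longrightarrow> alternation_le k w"
  unfolding alternation_le_def using sublist_length_le order_trans by blast

lemma alternation_le_sublist: "alternation_le k w \<Longrightarrow> sublist u w \<Longrightarrow> alternation_le k u"
  unfolding alternation_le_def using sublist_order.order.trans by blast

lemma alternation_le_rev_map:
  assumes "inj f" and "alternation_le k w"
  shows "alternation_le k (rev (map f w))"
  unfolding alternation_le_def
proof (intro allI impI)
  fix u assume "sublist u (rev (map f w))" and "distinct_adj u"
  then obtain u' where u': "sublist u' w" "rev u = map f u'"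
    by (metis sublist_map_rightE sublist_rev_right)
  have "distinct_adj (map f u')" using \<open>distinct_adj u\<close> u'(2) by (metis distinct_adj_rev)
  then have "length u' \<le> k"
    using assms(2) u'(1) by (auto simp: alternation_le_def dest: distinct_adj_mapD)
  then show "length u \<le> k" using arg_cong[OF u'(2), of length] by simp
qed

lemma alternation_le_append:
  assumes "alternation_le k p" "alternation_le k q"
    and "p \<noteq> []" "q \<noteq> []" "last p = hd q"
  shows "alternation_le k (p @ q)"
  unfolding alternation_le_def
proof (intro allI impI)
  fix u assume "sublist u (p @ q)" and adj: "distinct_adj u"
  then consider "sublist u p" | "sublist u q"
    | u1 u2 where "u = u1 @ u2" "suffix u1 p" "prefix u2 q"
    by (auto simp: sublist_append)
  then show "length u \<le> k"
  proof cases
    case 3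
    have "u1 = [] \<or> u2 = []"
    proof (rule ccontr)
      assume "\<not> (u1 = [] \<or> u2 = [])"
      then have "last u1 = last p" "hd u2 = hd q"
        using 3 by (auto simp: suffix_def prefix_def)
      then show False using adj 3(1) assms(5) \<open>\<not> (u1 = [] \<or> u2 = [])\<close>
        by (simp add: distinct_adj_append_iff)
    qed
    then show ?thesis using 3 assms(1,2) adj by (auto simp: alternation_le_def)
  qed (use assms(1,2) adj in \<open>auto simp: alternation_le_def\<close>)
qed

section \<open>Punctured balls\<close>

lemma equivp_pullback: "equivp R \<Longrightarrow> equivp (\<lambda>x y. R (f x) (f y))"
  unfolding equivp_reflp_symp_transp reflp_def symp_def transp_def by blast

definition punctured_ball_edge ::
  "'a set \<Rightarrow> ('a \<Rightarrow> 'a \<Rightarrow> bool) \<Rightarrow> nat \<Rightarrow> 'a \<Rightarrow> 'a \<Rightarrow> 'a \<Rightarrow> bool" where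
  "punctured_ball_edge V E r v x y \<longleftrightarrow> ball_edge V E r v x y \<and> x \<noteq> v \<and> y \<noteq> v"

abbreviation punctured_ball_connected ::
  "'a set \<Rightarrow> ('a \<Rightarrow> 'a \<Rightarrow> bool) \<Rightarrow> nat \<Rightarrow> 'a \<Rightarrow> 'a \<Rightarrow> 'a \<Rightarrow> bool" where
  "punctured_ball_connected V E r v \<equiv> (punctured_ball_edge V E r v)\<^sup>*\<^sup>*"

lemma equivp_punctured_ball_connected: "equivp (punctured_ball_connected V E r v)"
proof (rule equivp_rtranclp)
  show "symp (punctured_ball_edge V E r v)"
    unfolding symp_def punctured_ball_edge_def ball_edge_def by metis
qed

lemma walk_iff_successively: "walk V E xs \<longleftrightarrow> xs \<noteq> [] \<and> set xs \<subseteq> V \<and> successively E xs"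
  by (simp add: walk_def successively_conv_nth)

lemma closed_walk_through_rev:
  assumes "symp E" and "closed_walk_through V E r v xs"
  shows "closed_walk_through V E r v (rev xs)"
proof -
  have "successively E (rev xs) \<longleftrightarrow> successively E xs"
    unfolding successively_rev using assms(1) by (auto elim!: successively_mono dest: sympD)
  then show ?thesis
    using assms(2) by (simp add: closed_walk_through_def walk_iff_successively hd_rev last_rev)
qed

lemma punctured_ball_connected_along_walk:
  assumes "closed_walk_through V E r v xs" and "sublist ys xs" and "ys \<noteq> []" and "v \<notin> set ys"
  shows "punctured_ball_connected V E r v (hd ys) (last ys)"
proof (rule successively_imp_rtranclp_hd_last)
  have "successively (ball_edge V E r v) xs"
    unfolding successively_conv_nth ball_edge_def using assms(1) by blast
  then have "successively (ball_edge V E r v) ys" using assms(2) by (rule successively_sublist)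
  then show "successively (punctured_ball_edge V E r v) ys"
    by (rule successively_mono) (use assms(4) in \<open>auto simp: punctured_ball_edge_def\<close>)
qed (rule assms(3))

lemma ball_vert_connected_to_neighbour:
  assumes "symp E" and "a \<in> ball_verts V E r v" and "a \<noteq> v"
  obtains x where "E v x" and "punctured_ball_connected V E r v x a"
proof -
  obtain xs where xs: "closed_walk_through V E r v xs" "a \<in> set xs"
    using assms(2) by (auto simp: ball_verts_def)
  then have "v \<in> set xs" by (simp add: closed_walk_through_def)
  obtain ls rs where xs_split: "xs = ls @ a # rs" using xs(2) by (auto dest: split_list)
  have "\<exists>ws ps qs. closed_walk_through V E r v ws \<and> ws = ps @ a # qs \<and> v \<in> set ps"
  proof (cases "v \<in> set ls")
    case True
    then show ?thesis using xs(1) xs_split by blast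
  next
    case False
    then have "v \<in> set (rev rs)" using \<open>v \<in> set xs\<close> xs_split assms(3) by auto
    moreover have "rev xs = rev rs @ a # rev ls" by (simp add: xs_split)
    ultimately show ?thesis using closed_walk_through_rev[OF assms(1) xs(1)] by blast
  qed
  then obtain ws ps qs
    where closed_walk: "closed_walk_through V E r v ws" and "ws = ps @ a # qs" "v \<in> set ps"
    by blast
  moreover obtain ps' ys where "ps = ps' @ v # ys" and v_notin: "v \<notin> set ys"
    using split_list_last[OF \<open>v \<in> set ps\<close>] by blast
  ultimately have ws_split: "ws = (ps' @ [v]) @ (ys @ [a]) @ qs" by simp
  have "successively E ws"
    using closed_walk by (simp add: closed_walk_through_def walk_iff_successively)
  then have "E v (hd (ys @ [a]))"
    by (cases ys) (simp_all add: ws_split successively_append_iff successively_Cons)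
  moreover have "sublist (ys @ [a]) ws" unfolding ws_split by (rule sublist_appendI)
  then have "punctured_ball_connected V E r v (hd (ys @ [a])) (last (ys @ [a]))"
    using v_notin assms(3) by (intro punctured_ball_connected_along_walk[OF closed_walk]) simp_all
  ultimately show thesis using that by simp
qed

lemma local_cutvertex_disconnects_neighbours:
  assumes "symp E" and "local_cutvertex V E r v"
  obtains x y where "E v x" and "E v y" and "\<not> punctured_ball_connected V E r v x y"
proof -
  obtain a b where ab: "a \<in> ball_verts V E r v" "a \<noteq> v" "b \<in> ball_verts V E r v" "b \<noteq> v"
    "\<not> punctured_ball_connected V E r v a b"
    using assms(2) by (auto simp: local_cutvertex_def punctured_ball_edge_def[abs_def])
  obtain x where x: "E v x" "punctured_ball_connected V E r v x a"
    using ball_vert_connected_to_neighbour[OF assms(1) ab(1,2)] .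
  obtain y where y: "E v y" "punctured_ball_connected V E r v y b"
    using ball_vert_connected_to_neighbour[OF assms(1) ab(3,4)] .
  have "\<not> punctured_ball_connected V E r v x y"
    using x(2) y(2) ab(5) equivp_symp[OF equivp_punctured_ball_connected] rtranclp_trans
    by metis
  then show thesis using that x(1) y(1) by blast
qed

section \<open>Words and minimal relators\<close>

context monoid
begin

primrec word_prod :: "'a list \<Rightarrow> 'a" where
  "word_prod [] = \<one>"
| "word_prod (x # w) = x \<otimes> word_prod w"

lemma word_prod_closed [simp]: "set w \<subseteq> carrier G \<Longrightarrow> word_prod w \<in> carrier G"
  by (induction w) auto

lemma word_prod_append:
  "set p \<subseteq> carrier G \<Longrightarrow> set q \<subseteq> carrier G \<Longrightarrow> word_prod (p @ q) = word_prod p \<otimes> word_prod q"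
  by (induction p) (auto simp: m_assoc)

lemma word_prod_replicate: "s \<in> carrier G \<Longrightarrow> word_prod (replicate k s) = s [^] k"
proof (induction k)
  case (Suc k)
  then show ?case using nat_pow_Suc2[of s k] by simp
qed simp

definition minimal_relator :: "'a list \<Rightarrow> bool" where
  "minimal_relator w \<longleftrightarrow> w \<noteq> [] \<and> word_prod w = \<one> \<and>
     (\<forall>u. sublist u w \<longrightarrow> u \<noteq> [] \<longrightarrow> word_prod u = \<one> \<longrightarrow> u = w)"

lemma minimal_relatorD:
  assumes "minimal_relator w"
  shows "w \<noteq> []" and "word_prod w = \<one>"
    and "sublist u w \<Longrightarrow> u \<noteq> [] \<Longrightarrow> word_prod u = \<one> \<Longrightarrow> u = w"
  using assms by (auto simp: minimal_relator_def)

lemma minimal_relator_sublist_exists: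
  assumes "w \<noteq> []" "word_prod w = \<one>"
  obtains u where "sublist u w" "minimal_relator u"
proof -
  have "\<exists>u. sublist u w \<and> minimal_relator u"
    using assms
  proof (induction w rule: length_induct)
    case (1 w)
    show ?case
    proof (cases "minimal_relator w")
      case False
      then obtain u where u: "sublist u w" "u \<noteq> []" "word_prod u = \<one>" "u \<noteq> w"
        using "1.prems" by (auto simp: minimal_relator_def)
      then have "length u < length w" by (auto simp: sublist_def)
      then show ?thesis using "1.IH" u sublist_order.order.trans by blast
    qed blast
  qed
  then show thesis using that by blast
qed

end

context group
begin

lemma word_prod_rotate_eq_one:
  assumes "set p \<subseteq> carrier G" "set q \<subseteq> carrier G" "word_prod (p @ q) = \<one>"
  shows "word_prod (q @ p) = \<one>"
  using assms by (simp add: word_prod_append inv_comm)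

lemma minimal_relator_rotate:
  assumes "set (p @ q) \<subseteq> carrier G" and min: "minimal_relator (p @ q)"
  shows "minimal_relator (q @ p)"
  unfolding minimal_relator_def
proof (intro conjI allI impI)
  have closed: "set p \<subseteq> carrier G" "set q \<subseteq> carrier G" using assms(1) by auto
  show "q @ p \<noteq> []" using minimal_relatorD(1)[OF min] by auto
  show rotated_eq_one: "word_prod (q @ p) = \<one>"
    using word_prod_rotate_eq_one[OF closed] minimal_relatorD(2)[OF min] .
  fix u assume u: "sublist u (q @ p)" "u \<noteq> []" "word_prod u = \<one>"
  show "u = q @ p"
  proof (cases "sublist u p \<or> sublist u q")
    case True
    then have "sublist u (p @ q)" by (auto simp: sublist_append)
    then have "u = p @ q" using u(2,3) minimal_relatorD(3)[OF min] by blast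
    then have "length (p @ q) \<le> length p \<or> length (p @ q) \<le> length q"
      using True sublist_length_le by blast
    then have "p = [] \<or> q = []" by auto
    then show ?thesis using \<open>u = p @ q\<close> by auto
  next
    case False
    txt \<open>Then \<open>u\<close> crosses the seam, and its cyclic complement is a subword of \<open>p @ q\<close>.\<close>
    then obtain q2 p1 where "suffix q2 q" "prefix p1 p" "u = q2 @ p1"
      using u(1) unfolding sublist_append by blast
    then obtain q1 p2 where splits: "q = q1 @ q2" "p = p1 @ p2" "u = q2 @ p1"
      by (auto elim!: suffixE prefixE)
    have parts_closed: "set q1 \<subseteq> carrier G" "set q2 \<subseteq> carrier G"
        "set p1 \<subseteq> carrier G" "set p2 \<subseteq> carrier G"
      using closed splits by auto
    have "word_prod ((u @ p2) @ q1) = \<one>"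
      by (rule word_prod_rotate_eq_one) (use rotated_eq_one parts_closed in \<open>simp_all add: splits\<close>)
    moreover have "word_prod (u @ (p2 @ q1)) = word_prod u \<otimes> word_prod (p2 @ q1)"
      by (rule word_prod_append) (use parts_closed in \<open>simp_all add: splits(3)\<close>)
    ultimately have "word_prod (p2 @ q1) = \<one>" using u(3) parts_closed by simp
    moreover have "sublist (p2 @ q1) (p @ q)"
      using sublist_appendI[of "p2 @ q1" p1 q2] by (simp add: splits(1,2))
    moreover have "length (p2 @ q1) < length (p @ q)" using u(2) unfolding splits by auto
    then have "p2 @ q1 \<noteq> p @ q" by fastforce
    ultimately have "p2 @ q1 = []" using minimal_relatorD(3)[OF min] by blast
    then show ?thesis by (simp add: splits)
  qed
qed

end

section \<open>Signed letters and the word of an iterated commutator\<close>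

abbreviation flip :: "'x \<times> bool \<Rightarrow> 'x \<times> bool" where
  "flip \<equiv> apsnd Not"

text \<open>If \<open>[a,b]\<^sub>n = a t\<close>, then \<open>[a,b]\<^sub>n\<^sub>+\<^sub>1 = a (t\<^sup>-\<^sup>1 a\<^sup>-\<^sup>1) a\<^sup>-\<^sup>1 (a t)\<close>, where the last
  \<open>a\<close> cancels. So \<open>comm_word a b n\<close> is the reduced word of \<open>[a,b]\<^sub>n\<close>, but only for \<open>n \<ge> 1\<close>.\<close>
primrec comm_tail :: "'x \<Rightarrow> 'x \<Rightarrow> nat \<Rightarrow> ('x \<times> bool) list" where
  "comm_tail a b 0 = [(b, True)]"
| "comm_tail a b (Suc n) = rev (map flip (comm_tail a b n)) @ (a, False) # comm_tail a b n"

abbreviation comm_word :: "'x \<Rightarrow> 'x \<Rightarrow> nat \<Rightarrow> ('x \<times> bool) list" where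
  "comm_word a b n \<equiv> (a, True) # comm_tail a b n"

lemma comm_tail_neq_Nil [simp]: "comm_tail a b n \<noteq> []"
  by (induction n) auto

lemma set_comm_tail_letters: "fst ` set (comm_tail a b n) \<subseteq> {a, b}"
  by (induction n) auto

lemma length_comm_word: "length (comm_word a b n) = 2 ^ (n + 1)"
  by (induction n) auto

lemma last_comm_tail: "last (comm_tail a b n) = (b, True)"
  by (induction n) auto

lemma hd_comm_tail_Suc: "hd (comm_tail a b (Suc n)) = (b, False)"
  by (simp add: hd_rev last_map last_comm_tail)

lemma comm_tail_suffix:
  assumes "1 \<le> n"
  shows "suffix [(b, False), (a, False), (b, True)] (comm_tail a b n)"
  using assms
proof (induction rule: nat_induct_at_least)
  case (Suc n)
  then show ?case by (auto simp: suffix_def)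
qed simp

lemma comm_word_letters_alternate:
  assumes "a \<noteq> b"
  shows "distinct_adj (map fst (comm_word a b n))"
proof -
  have fst_hd: "fst (hd (comm_tail a b n)) = b" for n
    by (cases n) (simp_all add: hd_comm_tail_Suc del: comm_tail.simps(2))
  have "distinct_adj (map fst (comm_tail a b n))"
  proof (induction n)
    case (Suc n)
    moreover have "last (map fst (rev (map flip (comm_tail a b n)))) = b"
      using fst_hd by (simp add: last_map last_rev hd_map)
    ultimately show ?case
      using assms fst_hd[of n]
      by (simp add: distinct_adj_append_iff distinct_adj_Cons hd_map rev_map[symmetric])
  qed simp
  then show ?thesis using assms fst_hd[of n] by (simp add: distinct_adj_Cons hd_map)
qed

lemma comm_word_signs_alternation_le_3:
  "alternation_le 3 (map snd (comm_word a b n))"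
proof (induction n)
  case 0
  show ?case by (simp add: alternation_le_if_short)
next
  case (Suc n)
  define w where "w = map snd (comm_word a b n)"
  define w' where "w' = map snd (comm_tail a b (Suc n))"
  have w'_eq: "w' = rev (map Not w) @ map snd (comm_tail a b n)"
    by (simp add: w_def w'_def rev_map)
  show ?case
  proof (cases n)
    case 0
    have "alternation_le 3 ([True, False] @ [False, True])"
      by (rule alternation_le_append) (simp_all add: alternation_le_if_short)
    then show ?thesis by (simp add: 0)
  next
    case (Suc m)
    have "alternation_le 3 w'"
      unfolding w'_eq
    proof (rule alternation_le_append)
      show "alternation_le 3 (rev (map Not w))"
        using Suc.IH unfolding w_def by (intro alternation_le_rev_map) (auto intro: injI)
      show "alternation_le 3 (map snd (comm_tail a b n))"
        using Suc.IH by (rule alternation_le_sublist) (simp add: sublist_Cons_right)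
    qed (auto simp: w_def Suc hd_map hd_comm_tail_Suc simp del: comm_tail.simps(2))
    have "suffix [(b, False), (a, False), (b, True)] (comm_tail a b n)"
      by (rule comm_tail_suffix) (simp add: Suc)
    then obtain rest where w'_split: "w' = [False, True, True] @ rest"
      by (auto simp: w'_eq w_def suffix_def)
    have "alternation_le 3 ([True, False, True] @ True # rest)"
    proof (rule alternation_le_append)
      show "alternation_le 3 (True # rest)"
        using \<open>alternation_le 3 w'\<close> sublist_append_leftI[of "True # rest" "[False, True]"]
        by (auto simp: w'_split intro: alternation_le_sublist)
    qed (simp_all add: alternation_le_if_short)
    then show ?thesis using w'_split by (simp add: w'_def del: comm_tail.simps(2))
  qed
qed

context group
begin

fun signed :: "'a \<times> bool \<Rightarrow> 'a" where
  "signed (x, s) = (if s then x else inv x)"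

lemma signed_closed [simp]: "fst x \<in> carrier G \<Longrightarrow> signed x \<in> carrier G"
  by (cases x) auto

lemma signed_flip: "fst x \<in> carrier G \<Longrightarrow> signed (flip x) = inv (signed x)"
  by (cases x) auto

lemma word_prod_rev_flip:
  assumes "fst ` set w \<subseteq> carrier G"
  shows "word_prod (map signed (rev (map flip w))) = inv (word_prod (map signed w))"
  using assms
proof (induction w)
  case (Cons x w)
  then have "set (map signed (rev (map flip w))) \<subseteq> carrier G" "set (map signed w) \<subseteq> carrier G"
    by auto
  with Cons show ?case by (simp add: word_prod_append signed_flip inv_mult_group)
qed simp

lemma word_prod_comm_word:
  assumes gh_closed: "g \<in> carrier G" "h \<in> carrier G" and "1 \<le> n"
  shows "word_prod (map signed (comm_word g h n)) = iter_comm G n g h"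
  using \<open>1 \<le> n\<close>
proof (induction rule: nat_induct_at_least)
  case base
  then show ?case using gh_closed by (simp add: m_assoc)
next
  case (Suc n)
  define t where "t = word_prod (map signed (comm_tail g h n))"
  have letters: "fst ` set (comm_tail g h n) \<subseteq> carrier G"
    using set_comm_tail_letters[of g h n] gh_closed by blast
  then have words_closed: "set (map signed (comm_tail g h n)) \<subseteq> carrier G"
      "set (map signed (rev (map flip (comm_tail g h n)))) \<subseteq> carrier G"
    by auto
  then have t_closed: "t \<in> carrier G" unfolding t_def by (intro word_prod_closed)
  have "word_prod (map signed (comm_word g h (Suc n))) = g \<otimes> (inv t \<otimes> (inv g \<otimes> t))"
    using words_closed gh_closed
    by (simp add: word_prod_append word_prod_rev_flip[OF letters, simplified] flip: t_def)
  also have "\<dots> = g \<otimes> inv (g \<otimes> t) \<otimes> inv g \<otimes> (g \<otimes> t)"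
    using gh_closed t_closed by (simp add: inv_mult_group m_assoc[symmetric]) (simp add: m_assoc)
  also have "g \<otimes> t = iter_comm G n g h" using Suc.IH by (simp add: t_def)
  finally show ?case by simp
qed

lemma equiv_inv_commute:
  "x \<in> carrier G \<Longrightarrow> y \<in> carrier G \<Longrightarrow> equiv_inv G x y \<longleftrightarrow> equiv_inv G y x"
  by (auto simp: equiv_inv_def)

lemma equiv_inv_signed_iff:
  assumes "x \<in> carrier G" "y \<in> carrier G"
  shows "equiv_inv G (signed (x, s)) (signed (y, t)) \<longleftrightarrow> equiv_inv G x y"
  using assms by (auto simp: equiv_inv_def dest: inj_onD[OF inv_inj])

lemma equiv_inv_if_signed_mult_eq_one:
  assumes closed: "x \<in> carrier G" "y \<in> carrier G" and "signed (x, s) \<otimes> signed (y, t) = \<one>"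
  shows "equiv_inv G x y"
proof -
  have "signed (x, s) = inv (signed (y, t))"
    using assms by (intro inv_equality[symmetric]) (simp_all del: signed.simps)
  then show ?thesis using equiv_inv_signed_iff[OF closed] unfolding equiv_inv_def by blast
qed

lemma minimal_relator_three_letters_signs:
  assumes "x \<in> carrier G" "y \<in> carrier G"
    and min: "minimal_relator (map signed [(x, s), (y, t), (x, s')])"
  shows "s' = s"
proof (rule ccontr)
  assume "s' \<noteq> s"
  have "minimal_relator (map signed [(x, s')] @ map signed [(x, s), (y, t)])"
    by (rule minimal_relator_rotate) (use assms in auto)
  moreover have "sublist (map signed [(x, s'), (x, s)])
      (map signed [(x, s')] @ map signed [(x, s), (y, t)])"
    by (simp add: sublist_Cons_right)
  moreover have "word_prod (map signed [(x, s'), (x, s)]) = \<one>"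
    using \<open>s' \<noteq> s\<close> assms(1) by auto
  ultimately have
    "map signed [(x, s'), (x, s)] = map signed [(x, s')] @ map signed [(x, s), (y, t)]"
    by (intro minimal_relatorD(3)) simp_all
  then show False by simp
qed

end

text \<open>The pairs \<open>{flip x, y}\<close> for consecutive letters \<open>x\<close>, \<open>y\<close> of \<open>u\<close> are edges of a 4-cycle with
  vertices \<open>(a, True)\<close>, \<open>(b, True)\<close>, \<open>(a, False)\<close>, \<open>(b, False)\<close>, and so is the given pair. Three
  edges connect the 4-cycle. Three consecutive pairs fail to contribute two new edges exactly if the
  four signs alternate.\<close>
lemma long_word_connects_signs:
  fixes R :: "'x \<times> bool \<Rightarrow> 'x \<times> bool \<Rightarrow> bool"
  assumes equiv: "equivp R" and base: "R (a, True) (b, True)"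
    and u_split: "u = (a, s) # (b, t) # (a, s') # (b, t') # u'"
    and signs: "alternation_le 3 (map snd u)" and consecutive: "successively (\<lambda>x y. R (flip x) y) u"
    and letters: "fst x \<in> {a, b}" "fst y \<in> {a, b}"
  shows "R x y"
proof -
  obtain C :: "'x \<times> bool \<Rightarrow> 'x \<times> bool \<Rightarrow> bool" where C_eq: "\<And>x y. R x y \<longleftrightarrow> C x = C y"
    using equiv that[of R] unfolding equivp_def by blast
  have "sublist [s, t, s', t'] (map snd u)" by (simp add: u_split sublist_Cons_right)
  then have "\<not> distinct_adj [s, t, s', t']" using signs by (fastforce simp: alternation_le_def)
  then have agree: "s = t \<or> t = s' \<or> s' = t'" by auto
  have "R (a, \<not> s) (b, t)" "R (b, \<not> t) (a, s')" "R (a, \<not> s') (b, t')"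
    using consecutive unfolding u_split by simp_all
  then have "C (a, True) = C (a, False) \<and> C (b, True) = C (b, False)"
    using base agree unfolding C_eq by (metis (full_types))
  then have "C (l, p) = C (a, True)" if "l \<in> {a, b}" for l p
    using that base unfolding C_eq by (cases p) auto
  then show ?thesis using letters unfolding C_eq by (metis prod.collapse)
qed

lemma triangle_connects_signs:
  fixes R :: "'x \<times> bool \<Rightarrow> 'x \<times> bool \<Rightarrow> bool"
  assumes equiv: "equivp R" and edges: "R (a, \<not> s) (b, t)" "R (b, \<not> t) (a, s)" "R (a, \<not> s) (a, s)"
    and letters: "fst x \<in> {a, b}" "fst y \<in> {a, b}"
  shows "R x y"
proof -
  obtain C :: "'x \<times> bool \<Rightarrow> 'x \<times> bool \<Rightarrow> bool" where C_eq: "\<And>x y. R x y \<longleftrightarrow> C x = C y"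
    using equiv that[of R] unfolding equivp_def by blast
  have "C (l, p) = C (a, s)" if "l \<in> {a, b}" for l p
    using that edges unfolding C_eq by (cases s; cases p; cases t) auto
  then show ?thesis using letters unfolding C_eq by (metis prod.collapse)
qed

lemma alternating_word_connects_signs:
  fixes R :: "'x \<times> bool \<Rightarrow> 'x \<times> bool \<Rightarrow> bool"
  assumes equiv: "equivp R" and base: "R (g, True) (h, True)"
    and letters: "fst ` set u \<subseteq> {g, h}" "distinct_adj (map fst u)"
    and signs: "alternation_le 3 (map snd u)"
    and consecutive: "successively (\<lambda>x y. R (flip x) y) (u @ [hd u])"
    and "3 \<le> length u" and triangle: "\<And>a s b t s'. u = [(a, s), (b, t), (a, s')] \<Longrightarrow> s' = s"
    and xy_letters: "fst x \<in> {g, h}" "fst y \<in> {g, h}"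
  shows "R x y"
proof -
  obtain a s b t z u' where u_split: "u = (a, s) # (b, t) # z # u'"
    using \<open>3 \<le> length u\<close> by (auto simp: numeral_3_eq_3 Suc_le_length_iff)
  have ab_eq_gh: "(a = g \<and> b = h) \<or> (a = h \<and> b = g)" using letters unfolding u_split by auto
  then obtain s' where z_eq: "z = (a, s')" using letters unfolding u_split by (cases z) auto
  show ?thesis
  proof (cases u')
    case Nil
    then have "s' = s" using triangle u_split z_eq by blast
    then have "R (a, \<not> s) (b, t)" "R (b, \<not> t) (a, s)" "R (a, \<not> s) (a, s)"
      using consecutive unfolding u_split z_eq Nil by simp_all
    then show ?thesis by (rule triangle_connects_signs[OF equiv]) (use xy_letters ab_eq_gh in auto)
  next
    case (Cons z' u'')
    then obtain t' where z'_eq: "z' = (b, t')"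
      using letters ab_eq_gh unfolding u_split z_eq by (cases z') auto
    have "R (a, True) (b, True)" using base ab_eq_gh equivp_symp[OF equiv] by blast
    moreover have "u = (a, s) # (b, t) # (a, s') # (b, t') # u''"
      unfolding u_split z_eq Cons z'_eq ..
    moreover have "successively (\<lambda>x y. R (flip x) y) u"
      using consecutive by (simp add: successively_append_iff)
    ultimately show ?thesis
      using long_word_connects_signs[OF equiv] signs xy_letters ab_eq_gh by blast
  qed
qed

section \<open>Balls in Cayley graphs\<close>

lemma symp_cayley_adj: "symp (cayley_adj G S)"
  by (auto simp: symp_def cayley_adj_def)

context monoid
begin

primrec path_from :: "'a \<Rightarrow> 'a list \<Rightarrow> 'a list" where
  "path_from x [] = [x]"
| "path_from x (s # w) = x # path_from (x \<otimes> s) w"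

lemma path_from_neq_Nil [simp]: "path_from x w \<noteq> []"
  by (cases w) auto

lemma hd_path_from [simp]: "hd (path_from x w) = x"
  by (cases w) auto

lemma length_path_from [simp]: "length (path_from x w) = Suc (length w)"
  by (induction w arbitrary: x) auto

lemma path_from_snoc:
  assumes "x \<in> carrier G" "set (w @ [s]) \<subseteq> carrier G"
  shows "path_from x (w @ [s]) = path_from x w @ [x \<otimes> word_prod (w @ [s])]"
  using assms by (induction w arbitrary: x) (auto simp: m_assoc)

lemma last_path_from:
  assumes "x \<in> carrier G" "set w \<subseteq> carrier G"
  shows "last (path_from x w) = x \<otimes> word_prod w"
  using assms by (induction w arbitrary: x) (auto simp: m_assoc)

lemma in_path_fromD:
  assumes "x \<in> carrier G" "set w \<subseteq> carrier G" "y \<in> set (path_from x w)"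
  obtains p where "prefix p w" "y = x \<otimes> word_prod p"
proof -
  have "\<exists>p. prefix p w \<and> y = x \<otimes> word_prod p"
    using assms
  proof (induction w arbitrary: x)
    case (Cons s w)
    show ?case
    proof (cases "y = x")
      case True
      then show ?thesis using Cons.prems by (intro exI[of _ "[]"]) auto
    next
      case False
      then obtain p where "prefix p w" "y = (x \<otimes> s) \<otimes> word_prod p"
        using Cons.IH[of "x \<otimes> s"] Cons.prems by auto
      moreover have "set p \<subseteq> carrier G"
        using \<open>prefix p w\<close> Cons.prems by (auto dest: set_mono_prefix)
      ultimately show ?thesis using Cons.prems by (intro exI[of _ "s # p"]) (auto simp: m_assoc)
    qed
  qed auto
  then show thesis using that by blast
qed

end

lemma (in group) minimal_relator_path_avoids_start:
  assumes min: "minimal_relator (s # m @ w)" and "w \<noteq> []"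
    and closed: "set (s # m) \<subseteq> carrier G" "x \<in> carrier G"
  shows "x \<notin> set (path_from (x \<otimes> s) m)"
proof
  assume "x \<in> set (path_from (x \<otimes> s) m)"
  then obtain p where p: "prefix p m" and return: "x = x \<otimes> s \<otimes> word_prod p"
    using closed by (elim in_path_fromD[rotated 2]) auto
  have p_closed: "set p \<subseteq> carrier G" using p closed by (auto dest: set_mono_prefix)
  have "x \<otimes> word_prod (s # p) = x" using return p_closed closed by (simp add: m_assoc)
  then have "word_prod (s # p) = \<one>" using p_closed closed by simp
  moreover have "sublist (s # p) (s # m @ w)" using p by (auto simp: prefix_def)
  ultimately have "s # p = s # m @ w" using minimal_relatorD(3)[OF min] by blast
  then show False using p \<open>w \<noteq> []\<close> by (auto simp: prefix_def)
qed

locale cayley_graph = group G for G (structure) +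
  fixes S :: "'a set"
  assumes gens: "generating_set G S"
begin

lemma S_carrier: "S \<subseteq> carrier G" and one_notin_S: "\<one> \<notin> S"
  and S_inv: "s \<in> S \<Longrightarrow> inv s \<in> S" and S_generates: "generate G S = carrier G"
  using gens by (auto simp: generating_set_def)

lemma cayley_adj_iff:
  "cayley_adj G S x y \<longleftrightarrow> x \<in> carrier G \<and> y \<in> carrier G \<and> (\<exists>s\<in>S. y = x \<otimes> s)"
proof -
  have "\<exists>s\<in>S. y = x \<otimes> s" if "s \<in> S" "x = y \<otimes> s" "y \<in> carrier G" for s
    using that S_inv S_carrier by (intro bexI[of _ "inv s"]) (auto simp: m_assoc)
  then show ?thesis by (auto simp: cayley_adj_def)
qed

lemma walk_path_from:
  assumes "x \<in> carrier G" "set w \<subseteq> S"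
  shows "walk (carrier G) (cayley_adj G S) (path_from x w)"
  using assms
proof (induction w arbitrary: x)
  case (Cons s w)
  then have "x \<otimes> s \<in> carrier G" using S_carrier by auto
  then show ?case
    using Cons by (auto simp: walk_iff_successively successively_Cons cayley_adj_iff)
qed (simp add: walk_iff_successively)

lemma minimal_relator_length:
  assumes "minimal_relator w" "set w \<subseteq> S"
  shows "2 \<le> length w"
proof (rule ccontr)
  assume "\<not> 2 \<le> length w"
  then obtain x where "w = [x]"
    using minimal_relatorD(1)[OF assms(1)] by (cases w; cases "tl w") auto
  then show False using minimal_relatorD(2)[OF assms(1)] assms(2) one_notin_S S_carrier by auto
qed

lemma signed_in_S: "fst x \<in> S \<Longrightarrow> signed x \<in> S"
  by (cases x) (auto simp: S_inv)

end

locale cayley_ball = cayley_graph +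
  fixes r :: nat and v :: 'a
  assumes v_closed [simp]: "v \<in> carrier G"
begin

definition linked :: "'a \<Rightarrow> 'a \<Rightarrow> bool" where
  "linked s t \<longleftrightarrow> punctured_ball_connected (carrier G) (cayley_adj G S) r v (v \<otimes> s) (v \<otimes> t)"

lemma equivp_linked: "equivp linked"
  unfolding linked_def[abs_def] by (rule equivp_pullback) (rule equivp_punctured_ball_connected)

lemmas linked_refl = equivp_reflp[OF equivp_linked]
  and linked_sym = equivp_symp[OF equivp_linked]
  and linked_trans = equivp_transp[OF equivp_linked]

lemma minimal_relator_linked:
  assumes min: "minimal_relator w" and in_S: "set w \<subseteq> S" and "length w \<le> r"
  shows "linked (hd w) (inv (last w))"
proof -
  obtain s m t where w_split: "w = s # m @ [t]"
    using minimal_relator_length[OF min in_S] by (cases w; cases "tl w" rule: rev_cases) auto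
  have closed: "s \<in> carrier G" "set m \<subseteq> carrier G" "t \<in> carrier G" "set w \<subseteq> carrier G"
    using in_S S_carrier by (auto simp: w_split)
  define ys where "ys = path_from (v \<otimes> s) m"
  have path: "path_from v w = v # ys @ [v]"
    using closed minimal_relatorD(2)[OF min] path_from_snoc[of "v \<otimes> s" m t]
    by (simp add: w_split ys_def m_assoc)
  have closed_walk: "closed_walk_through (carrier G) (cayley_adj G S) r v (path_from v w)"
    using walk_path_from[of v w] in_S \<open>length w \<le> r\<close> path
    unfolding closed_walk_through_def by (simp add: w_split ys_def)
  have "v \<notin> set ys"
    using minimal_relator_path_avoids_start[of s m "[t]" v] min closed by (simp add: w_split ys_def)
  then have "punctured_ball_connected (carrier G) (cayley_adj G S) r v (hd ys) (last ys)"
    using sublist_appendI[of ys "[v]" "[v]"] path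
    by (intro punctured_ball_connected_along_walk[OF closed_walk]) (auto simp: ys_def)
  moreover have "last ys = v \<otimes> inv t"
  proof -
    have "s \<otimes> word_prod m \<otimes> t = \<one>"
      using minimal_relatorD(2)[OF min] closed by (simp add: w_split word_prod_append m_assoc)
    then have "s \<otimes> word_prod m = inv t" using closed by (intro inv_equality[symmetric]) auto
    then show ?thesis using closed by (simp add: ys_def last_path_from m_assoc)
  qed
  ultimately show ?thesis by (simp add: linked_def w_split ys_def)
qed

lemma minimal_relator_consecutive_linked:
  assumes min: "minimal_relator w" and in_S: "set w \<subseteq> S" and "length w \<le> r"
  shows "successively (\<lambda>x y. linked (inv x) y) (w @ [hd w])"
  unfolding successively_iff_sublist
proof (intro allI impI)
  fix x y assume "sublist [x, y] (w @ [hd w])"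
  then consider "suffix [x, y] (w @ [hd w])" | "sublist [x, y] w" by (auto simp: sublist_snoc)
  then show "linked (inv x) y"
  proof cases
    case 1
    then have "y = hd w" "x = last w"
      by (auto simp: suffix_def append_eq_append_conv2 Cons_eq_append_conv)
    then show ?thesis using minimal_relator_linked[OF assms] linked_sym by blast
  next
    case 2
    then obtain p q where w_split: "w = (p @ [x]) @ (y # q)" by (auto simp: sublist_def)
    have "minimal_relator ((y # q) @ (p @ [x]))"
      by (rule minimal_relator_rotate) (use min in_S S_carrier in \<open>auto simp: w_split\<close>)
    then have "linked (hd ((y # q) @ (p @ [x]))) (inv (last ((y # q) @ (p @ [x]))))"
      using in_S \<open>length w \<le> r\<close> by (intro minimal_relator_linked) (auto simp: w_split)
    then show ?thesis using linked_sym by simp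
  qed
qed

lemma minimal_relator_signed_consecutive_linked:
  assumes min: "minimal_relator (map signed u)" and letters: "fst ` set u \<subseteq> S" and "length u \<le> r"
  shows "successively (\<lambda>x y. linked (signed (flip x)) (signed y)) (u @ [hd u])"
proof -
  have "u \<noteq> []" using minimal_relatorD(1)[OF min] by simp
  have "set (map signed u) \<subseteq> S" using letters by (auto intro!: signed_in_S simp del: signed.simps)
  then have "successively (\<lambda>x y. linked (inv x) y) (map signed u @ [hd (map signed u)])"
    using min \<open>length u \<le> r\<close> by (intro minimal_relator_consecutive_linked) auto
  also have "map signed u @ [hd (map signed u)] = map signed (u @ [hd u])"
    using \<open>u \<noteq> []\<close> by (simp add: hd_map)
  finally have "successively (\<lambda>x y. linked (inv (signed x)) (signed y)) (u @ [hd u])"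
    by (simp only: successively_map)
  then show ?thesis
  proof (rule successively_mono)
    fix x y assume "x \<in> set (u @ [hd u])" and inv_linked: "linked (inv (signed x)) (signed y)"
    then have "x \<in> set u" using \<open>u \<noteq> []\<close> by auto
    then have "fst x \<in> carrier G" using letters S_carrier by auto
    then show "linked (signed (flip x)) (signed y)" using inv_linked by (simp add: signed_flip)
  qed
qed

lemma commutator_minimal_relator:
  assumes "g \<in> S" "h \<in> S" "g \<noteq> h" and "1 \<le> n" "2 ^ (n + 1) \<le> r"
    and trivial: "iter_comm G n g h = \<one>"
  obtains u where "minimal_relator (map signed u)" "2 \<le> length u" "fst ` set u \<subseteq> {g, h}"
    "distinct_adj (map fst u)" "alternation_le 3 (map snd u)"
    "successively (\<lambda>x y. linked (signed (flip x)) (signed y)) (u @ [hd u])"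
proof -
  define w where "w = comm_word g h n"
  have "word_prod (map signed w) = \<one>"
    using word_prod_comm_word[of g h n] assms S_carrier unfolding w_def by auto
  then obtain w' where "sublist w' (map signed w)" "minimal_relator w'"
    using minimal_relator_sublist_exists[of "map signed w"] by (auto simp: w_def)
  then obtain u where u: "sublist u w" and min: "minimal_relator (map signed u)"
    using sublist_map_rightE by blast
  have letters: "fst ` set u \<subseteq> {g, h}"
    using set_mono_sublist[OF u] set_comm_tail_letters[of g h n] by (force simp: w_def)
  then have letters_in_S: "fst ` set u \<subseteq> S" using assms(1,2) by auto
  have "set (map signed u) \<subseteq> S"
    using letters_in_S by (auto intro!: signed_in_S simp del: signed.simps)
  then have "2 \<le> length u" using minimal_relator_length[OF min] by simp
  have "length u \<le> r"
    using sublist_length_le[OF u] length_comm_word[of g h n] assms(5) by (simp add: w_def)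
  note minimal_relator_signed_consecutive_linked[OF min letters_in_S this]
  moreover have "distinct_adj (map fst w)"
    unfolding w_def using assms(3) by (rule comm_word_letters_alternate)
  then have "distinct_adj (map fst u)"
    unfolding distinct_adj_def using map_mono_sublist[OF u] by (rule successively_sublist)
  moreover have "alternation_le 3 (map snd w)"
    unfolding w_def by (rule comm_word_signs_alternation_le_3)
  then have "alternation_le 3 (map snd u)"
    using map_mono_sublist[OF u] by (rule alternation_le_sublist)
  ultimately show thesis using that min \<open>2 \<le> length u\<close> letters by blast
qed

lemma some_signs_linked:
  assumes "g \<in> S" "h \<in> S" "g \<noteq> h" and "1 \<le> n" "2 ^ (n + 1) \<le> r" and "iter_comm G n g h = \<one>"
  obtains s t where "linked (signed (g, s)) (signed (h, t))"
proof -
  obtain u where "2 \<le> length u"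
    and letters: "fst ` set u \<subseteq> {g, h}" "distinct_adj (map fst u)"
    and consecutive: "successively (\<lambda>x y. linked (signed (flip x)) (signed y)) (u @ [hd u])"
    by (rule commutator_minimal_relator[OF assms])
  obtain a s b t u' where u_eq: "u = (a, s) # (b, t) # u'"
    using \<open>2 \<le> length u\<close> by (cases u; cases "tl u") auto
  have "linked (signed (a, \<not> s)) (signed (b, t))" using consecutive unfolding u_eq by simp
  moreover have "(a = g \<and> b = h) \<or> (a = h \<and> b = g)" using letters unfolding u_eq by auto
  ultimately show thesis using that linked_sym by blast
qed

lemma all_signs_linked:
  assumes gh: "g \<in> S" "h \<in> S" "\<not> equiv_inv G g h"
    and n_bounds: "1 \<le> n" "2 ^ (n + 1) \<le> r" and trivial: "iter_comm G n g h = \<one>"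
    and "linked g h" and xy_letters: "fst x \<in> {g, h}" "fst y \<in> {g, h}"
  shows "linked (signed x) (signed y)"
proof -
  have gh_closed: "g \<in> carrier G" "h \<in> carrier G" using gh S_carrier by auto
  have "g \<noteq> h" using gh(3) by (simp add: equiv_inv_def)
  then obtain u where min: "minimal_relator (map signed u)" and "2 \<le> length u"
      and letters: "fst ` set u \<subseteq> {g, h}" "distinct_adj (map fst u)"
      and signs: "alternation_le 3 (map snd u)"
      and consecutive: "successively (\<lambda>x y. linked (signed (flip x)) (signed y)) (u @ [hd u])"
    by (rule commutator_minimal_relator[OF gh(1,2) _ n_bounds trivial])
  have "length u \<noteq> 2"
  proof
    assume "length u = 2"
    then obtain a s b t where u_eq: "u = [(a, s), (b, t)]"
      by (auto simp: numeral_2_eq_2 length_Suc_conv)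
    have ab_eq_gh: "(a = g \<and> b = h) \<or> (a = h \<and> b = g)" using letters unfolding u_eq by auto
    then have ab_closed: "a \<in> carrier G" "b \<in> carrier G" using gh_closed by auto
    then have "signed (a, s) \<otimes> signed (b, t) = \<one>"
      using minimal_relatorD(2)[OF min] unfolding u_eq by (simp del: signed.simps)
    then have "equiv_inv G a b" by (rule equiv_inv_if_signed_mult_eq_one[OF ab_closed])
    then show False using gh(3) ab_eq_gh equiv_inv_commute[OF gh_closed] by blast
  qed
  show ?thesis
  proof (rule alternating_word_connects_signs[OF _ _ letters signs consecutive _ _ xy_letters])
    show "equivp (\<lambda>x y. linked (signed x) (signed y))"
      using equivp_linked by (rule equivp_pullback)
    show "linked (signed (g, True)) (signed (h, True))" using \<open>linked g h\<close> by simp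
    show "3 \<le> length u" using \<open>2 \<le> length u\<close> \<open>length u \<noteq> 2\<close> by simp
    fix a s b t s' assume u_eq: "u = [(a, s), (b, t), (a, s')]"
    then have "a \<in> carrier G" "b \<in> carrier G" using letters(1) gh_closed by auto
    then show "s' = s" using min unfolding u_eq by (rule minimal_relator_three_letters_signs)
  qed
qed

lemma linked_if_not_equiv_inv:
  assumes gh: "g \<in> S" "h \<in> S" "\<not> equiv_inv G g h"
    and n_bounds: "1 \<le> n" "2 ^ (n + 1) \<le> r" and nilpotent: "nilpotent_class_le G n"
  shows "linked g h"
proof -
  have gh_closed: "g \<in> carrier G" "h \<in> carrier G" using gh S_carrier by auto
  have trivial: "iter_comm G n x y = \<one>" if "x \<in> S" "y \<in> S" "\<not> equiv_inv G x y" for x y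
    using nilpotent that S_carrier by (auto simp: nilpotent_class_le_def)
  have "g \<noteq> h" using gh(3) by (simp add: equiv_inv_def)
  then obtain s t where signed_linked: "linked (signed (g, s)) (signed (h, t))"
    using some_signs_linked[OF gh(1,2) _ n_bounds trivial[OF gh]] by blast
  define g' h' where "g' = signed (g, s)" and "h' = signed (h, t)"
  have in_S: "g' \<in> S" "h' \<in> S" using gh by (auto simp: g'_def h'_def S_inv)
  have not_equiv_inv: "\<not> equiv_inv G g' h'"
    unfolding g'_def h'_def equiv_inv_signed_iff[OF gh_closed] by (rule gh(3))
  have "linked g' h'" unfolding g'_def h'_def by (rule signed_linked)
  then have "linked (signed (g', s)) (signed (h', t))"
    by (intro all_signs_linked[OF in_S not_equiv_inv n_bounds trivial[OF in_S not_equiv_inv]])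
      simp_all
  then show ?thesis using gh_closed by (cases s; cases t) (auto simp: g'_def h'_def)
qed

lemma local_cutvertex_imp_single_generator:
  assumes "local_cutvertex (carrier G) (cayley_adj G S) r v"
    and all_linked: "\<And>x y. x \<in> S \<Longrightarrow> y \<in> S \<Longrightarrow> \<not> equiv_inv G x y \<Longrightarrow> linked x y"
  obtains s where "S = {s, inv s}" "\<not> linked s (inv s)"
proof -
  obtain x y where "cayley_adj G S v x" "cayley_adj G S v y"
    "\<not> punctured_ball_connected (carrier G) (cayley_adj G S) r v x y"
    using local_cutvertex_disconnects_neighbours[OF symp_cayley_adj assms(1)] .
  then obtain s t where st_in_S: "s \<in> S" "t \<in> S" and not_linked: "\<not> linked s t"
    by (auto simp: cayley_adj_iff linked_def)
  have s_closed: "s \<in> carrier G" using st_in_S S_carrier by auto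
  have t_eq: "t = inv s"
    using all_linked[OF st_in_S(2,1)] not_linked linked_sym linked_refl
    by (auto simp: equiv_inv_def)
  have "x \<in> {s, t}" if "x \<in> S" for x
  proof (rule ccontr)
    assume "x \<notin> {s, t}"
    then have "\<not> equiv_inv G x s" "\<not> equiv_inv G x t"
      using s_closed t_eq by (auto simp: equiv_inv_def)
    then have "linked x s" "linked x t" using all_linked that st_in_S by blast+
    then show False using not_linked linked_sym linked_trans by blast
  qed
  then show thesis using that st_in_S not_linked t_eq by blast
qed

lemma ord_gt_if_not_linked_inv:
  assumes "s \<in> S" "\<not> linked s (inv s)" "0 < ord s"
  shows "r < ord s"
proof (rule ccontr)
  assume "\<not> r < ord s"
  have "s \<in> carrier G" using assms(1) S_carrier by auto
  then have "word_prod (replicate (ord s) s) = \<one>" by (simp add: word_prod_replicate)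
  then obtain u where sublist: "sublist u (replicate (ord s) s)" and min: "minimal_relator u"
    using minimal_relator_sublist_exists[of "replicate (ord s) s"] assms(3) by auto
  have "set u \<subseteq> {s}" using set_mono_sublist[OF sublist] by auto
  moreover have "length u \<le> r" using sublist_length_le[OF sublist] \<open>\<not> r < ord s\<close> by simp
  ultimately have "linked (hd u) (inv (last u))"
    using min assms(1) by (intro minimal_relator_linked) auto
  moreover have "hd u = s" "last u = s"
    using \<open>set u \<subseteq> {s}\<close> minimal_relatorD(1)[OF min] by (auto dest: hd_in_set last_in_set)
  ultimately show False using assms(2) by simp
qed

end

section \<open>Cayley graphs of cyclic groups\<close>

context group
begin

lemma generate_insert_inv:
  assumes "s \<in> carrier G"
  shows "generate G {s, inv s} = generate G {s}"
proof
  have "{s, inv s} \<subseteq> generate G {s}" by (auto intro: generate.intros)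
  then show "generate G {s, inv s} \<subseteq> generate G {s}"
    using generate_subgroup_incl generate_is_subgroup assms by simp
  show "generate G {s} \<subseteq> generate G {s, inv s}" by (rule mono_generate) simp
qed

lemma bij_betw_pow_generate:
  assumes "s \<in> carrier G" "0 < ord s"
  shows "bij_betw (\<lambda>i::nat. s [^] i) {..<ord s} (generate G {s})"
proof -
  have interval: "{0..ord s - 1} = {..<ord s}" using assms(2) by auto
  have "generate G {s} = (\<lambda>i::nat. s [^] i) ` {..<ord s}"
    using generate_pow_nat ord_elems_inf_carrier assms unfolding interval by auto
  then show ?thesis
    using ord_inj[OF assms(1)] unfolding interval by (simp add: bij_betw_def)
qed

lemma cayley_graph_is_cycle:
  assumes s_closed: "s \<in> carrier G" and gen: "generate G {s} = carrier G" and "3 \<le> ord s"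
  shows "is_cycle_graph (carrier G) (cayley_adj G {s, inv s}) (ord s)"
proof -
  define f where "f i = s [^] i" for i :: nat
  have bij: "bij_betw f {..<ord s} (carrier G)"
    using bij_betw_pow_generate[OF s_closed] gen assms(3) by (simp add: f_def[abs_def])
  then have carrier_eq: "carrier G = f ` {..<ord s}" by (simp add: bij_betw_def)
  have succ: "f (Suc i mod ord s) = f i \<otimes> s" if "i < ord s" for i
  proof (cases "Suc i = ord s")
    case True
    then have "f i \<otimes> s = \<one>" using nat_pow_Suc[of s i] pow_ord_eq_1[OF s_closed] by (simp add: f_def)
    then show ?thesis using True by (simp add: f_def)
  next
    case False
    then show ?thesis using that by (simp add: f_def)
  qed
  have adj: "cayley_adj G {s, inv s} x y \<longleftrightarrow>
      x \<in> carrier G \<and> y \<in> carrier G \<and> (y = x \<otimes> s \<or> x = y \<otimes> s)" for x y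
    using s_closed by (auto simp: cayley_adj_def m_assoc)
  have "cayley_adj G {s, inv s} x y \<longleftrightarrow>
      (\<exists>i<ord s. (x = f i \<and> y = f (Suc i mod ord s)) \<or> (y = f i \<and> x = f (Suc i mod ord s)))" for x y
  proof
    assume "cayley_adj G {s, inv s} x y"
    then have "x \<in> f ` {..<ord s}" "y \<in> f ` {..<ord s}" "y = x \<otimes> s \<or> x = y \<otimes> s"
      unfolding adj carrier_eq by auto
    then show "\<exists>i<ord s. (x = f i \<and> y = f (Suc i mod ord s)) \<or> (y = f i \<and> x = f (Suc i mod ord s))"
      using succ by fastforce
  next
    assume "\<exists>i<ord s. (x = f i \<and> y = f (Suc i mod ord s)) \<or> (y = f i \<and> x = f (Suc i mod ord s))"
    moreover have "f i \<in> carrier G" for i using s_closed by (simp add: f_def)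
    ultimately show "cayley_adj G {s, inv s} x y" unfolding adj using succ by metis
  qed
  then show ?thesis using assms(3) bij unfolding is_cycle_graph_def by blast
qed

lemma cyclic_group_if_generate:
  assumes "s \<in> carrier G" "generate G {s} = carrier G"
  shows "cyclic_group G"
  unfolding cyclic_group using generate_pow[OF assms(1)] assms by auto

end

theorem theorem4p1:
  fixes G :: "('a, 'b) monoid_scheme" and S :: "'a set" and n r :: nat
  assumes "group G" and "finite (carrier G)"
    and "generating_set G S"
    and "n \<ge> 1" and "nilpotent_class_le G n"
    and "r \<ge> 2 ^ (n + 1)"
    and "\<exists>v. local_cutvertex (carrier G) (cayley_adj G S) r v"
  shows "(\<exists>m > r. is_cycle_graph (carrier G) (cayley_adj G S) m) \<and> cyclic_group G"
proof -
  obtain v where cutvertex: "local_cutvertex (carrier G) (cayley_adj G S) r v"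
    using assms(7) by blast
  interpret cayley_ball G S r v
    using assms(1,3) cutvertex
    by (intro cayley_ball.intro cayley_graph.intro cayley_graph_axioms.intro
        cayley_ball_axioms.intro) (auto simp: local_cutvertex_def)
  obtain s where S_eq: "S = {s, inv\<^bsub>G\<^esub> s}" and not_linked: "\<not> linked s (inv\<^bsub>G\<^esub> s)"
    using local_cutvertex_imp_single_generator[OF cutvertex] linked_if_not_equiv_inv assms(4-6)
    by metis
  then have s_closed: "s \<in> carrier G" using S_carrier by auto
  have gen: "generate G {s} = carrier G"
    using S_generates generate_insert_inv[OF s_closed] S_eq by simp
  have "r < ord s"
    using S_eq not_linked ord_ge_1[OF assms(2) s_closed] by (intro ord_gt_if_not_linked_inv) auto
  moreover have "(2::nat) ^ 2 \<le> 2 ^ (n + 1)" using assms(4) by (intro power_increasing) auto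
  then have "3 \<le> ord s" using \<open>r < ord s\<close> assms(6) by simp
  then have "is_cycle_graph (carrier G) (cayley_adj G S) (ord s)"
    using cayley_graph_is_cycle[OF s_closed gen] S_eq by simp
  ultimately show ?thesis using cyclic_group_if_generate[OF s_closed gen] by blast
qed

end
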